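(* Under full-order clustering ($n=K$) with i.i.d. channel gains and in the high-SINR regime ($\bar\gamma\to\infty$), the probability of outage of the GCoMP-enabled NOMA scheme can be expressed as $$P_{\rm out}^{(K)}\approx\left(\left(\frac{K\,\Gamma(K)}{M(\gamma_{\rm th}')^{K}}\right)^{1/K}\bar\gamma\right)^{-K},$$ where $\bar\gamma=2P\sigma^2/N$.
   Context: Setting (generalized coordinated multipoint, GCoMP, downlink with non-orthogonal multiple access, NOMA): $K$ base stations, each with power budget $P$, jointly serve all $M$ users of one NOMA cluster (full-order clustering, so there is no inter-cell interference) over i.i.d. channels whose power gains are exponential with rate $1/(2\sigma^2)$; $N$ is the noise level. The outage probability in this setting is given by $$P_{\rm out}^{(K)}=\sum_{m=1}^{M}\binom{M}{m}\,\gamma(K,\alpha\gamma_{\rm th}')^m\left(1-\gamma(K,\alpha\gamma_{\rm th}')\right)^{M-m},\qquad \alpha=\frac{N}{2P\sigma^2}=\frac1{\bar\gamma},$$ where $\gamma(K,x)=\frac{1}{\Gamma(K)}\int_0^x t^{K-1}e^{-t}\,dt$ is the normalized lower incomplete gamma function and $\Gamma$ is the gamma function. The effective threshold is $\gamma_{\rm th}'=\gamma_{\rm th}P/\max_\delta(\Lambda^\delta-\gamma_{\rm th}\Delta^\delta)$, where $\gamma_{\rm th}$ is the SINR threshold of every user, $\Lambda^\delta=a_\delta P$, $\Delta^\delta=P\sum_{i>\delta}a_i$, $a_i$ is the NOMA power fraction of the $i$-th user in the decoding order, and $\delta$ ranges over the signals to be decoded. The sign $\approx$ denotes the approximation obtained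 by inserting the series representation of $\gamma(K,\alpha\gamma_{\rm th}')$ in the formula for $P_{\rm out}^{(K)}$ and keeping only the first (dominant) term; no error estimate is asserted. *)

theory Defs
  imports
    "HOL-Analysis.Analysis"
    "HOL-Library.Landau_Symbols"
begin

(* Meant for K > 0 and x >= 0. *)
definition norm_lower_inc_gamma :: "nat \<Rightarrow> real \<Rightarrow> real" where
  "norm_lower_inc_gamma K x =
     integral {0..x} (\<lambda>t. t ^ (K - 1) * exp (- t)) / Gamma (real K)"

(* Users, and hence their signals, are numbered 1..M in decoding order; a i is the power
   fraction of user i. *)
definition signal_power :: "(nat \<Rightarrow> real) \<Rightarrow> real \<Rightarrow> nat \<Rightarrow> real" where
  "signal_power a P \<delta> = a \<delta> * P"

definition interference_power :: "nat \<Rightarrow> (nat \<Rightarrow> real) \<Rightarrow> real \<Rightarrow> nat \<Rightarrow> real" where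
  "interference_power M a P \<delta> = P * (\<Sum>i\<in>{\<delta><..M}. a i)"

(* D is the set of signals to be decoded. *)
definition max_margin ::
    "nat set \<Rightarrow> nat \<Rightarrow> (nat \<Rightarrow> real) \<Rightarrow> real \<Rightarrow> real \<Rightarrow> real" where
  "max_margin D M a \<gamma>th P =
     (MAX \<delta>\<in>D. signal_power a P \<delta> - \<gamma>th * interference_power M a P \<delta>)"

definition eff_threshold ::
    "nat set \<Rightarrow> nat \<Rightarrow> (nat \<Rightarrow> real) \<Rightarrow> real \<Rightarrow> real \<Rightarrow> real" where
  "eff_threshold D M a \<gamma>th P = \<gamma>th * P / max_margin D M a \<gamma>th P"

(* The power gains are exponential with rate 1 / (2 * sigma^2), i.e. with mean 2 * sigma^2. *)
definition mean_sinr :: "real \<Rightarrow> real \<Rightarrow> real \<Rightarrow> real" where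
  "mean_sinr P \<sigma> N = 2 * P * \<sigma>\<^sup>2 / N"

(* Outage probability of a cluster of M users jointly served by K base stations over i.i.d.
   channels: a single user is in outage with probability p. *)
definition outage_prob ::
    "nat \<Rightarrow> nat \<Rightarrow> nat set \<Rightarrow> (nat \<Rightarrow> real) \<Rightarrow> real \<Rightarrow> real \<Rightarrow> real \<Rightarrow> real \<Rightarrow> real" where
  "outage_prob K M D a \<gamma>th P \<sigma> N =
     (let \<alpha> = N / (2 * P * \<sigma>\<^sup>2);
          p = norm_lower_inc_gamma K (\<alpha> * eff_threshold D M a \<gamma>th P)
      in \<Sum>m=1..M. real (M choose m) * p ^ m * (1 - p) ^ (M - m))"

definition high_sinr_outage ::
    "nat \<Rightarrow> nat \<Rightarrow> nat set \<Rightarrow> (nat \<Rightarrow> real) \<Rightarrow> real \<Rightarrow> real \<Rightarrow> real \<Rightarrow> real \<Rightarrow> real" where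
  "high_sinr_outage K M D a \<gamma>th P \<sigma> N =
     ((real K * Gamma (real K) / (real M * eff_threshold D M a \<gamma>th P ^ K)) powr (1 / real K)
        * mean_sinr P \<sigma> N) powr (- real K)"

end

theory Submission
  imports Defs
begin

text \<open>
  The effective threshold does not depend on the power budget, because the margin is linear in it,
  so the outage probability is a fixed function of the single variable \<open>1 / mean_sinr\<close>.
  Integrating the exponential series termwise shows that \<open>norm_lower_inc_gamma K x\<close> equals
  \<open>x ^ K\<close> times an entire power series. The outage probability is \<open>1 - (1 - p) ^ M\<close>, which is
  \<open>p\<close> times a geometric sum in \<open>1 - p\<close>, hence again \<open>x ^ K\<close> times an entire series, whose constant
  term is read off at \<open>p = 0\<close>. Continuity of that series at \<open>0\<close> gives the asymptotic equivalence.
\<close>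

section \<open>Power series of the lower incomplete gamma function\<close>

text \<open>Termwise integral of \<open>t ^ (K - 1) * exp (- t)\<close> over \<open>{0..x}\<close>
  with the factor \<open>x ^ K\<close> removed; the normalization by \<open>Gamma (real K)\<close>
  is left out here.\<close>

definition inc_gamma_fps :: "nat \<Rightarrow> real fps" where
  "inc_gamma_fps K = Abs_fps (\<lambda>n. (- 1) ^ n / (fact n * real (K + n)))"

lemma fps_conv_radius_inc_gamma_fps [simp]:
  assumes "K \<ge> 1"
  shows "fps_conv_radius (inc_gamma_fps K) = \<infinity>"
  unfolding fps_conv_radius_def
proof (rule conv_radius_inftyI'')
  fix z :: real
  show "summable (\<lambda>n. fps_nth (inc_gamma_fps K) n * z ^ n)"
  proof (rule summable_comparison_test)
    show "\<exists>m. \<forall>n\<ge>m. norm (fps_nth (inc_gamma_fps K) n * z ^ n) \<le> inverse (fact n) * \<bar>z\<bar> ^ n"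
    proof (intro exI allI impI)
      fix n :: nat
      have "1 / (fact n * real (K + n)) \<le> 1 / (fact n :: real)"
        using assms by (intro divide_left_mono) (auto simp: mult_le_cancel_left1)
      then show "norm (fps_nth (inc_gamma_fps K) n * z ^ n) \<le> inverse (fact n) * \<bar>z\<bar> ^ n"
        by (auto simp: inc_gamma_fps_def abs_mult power_abs inverse_eq_divide
            intro!: mult_right_mono simp del: of_nat_add times_divide_eq_left)
    qed
    show "summable (\<lambda>n. inverse (fact n) * \<bar>z\<bar> ^ n)"
      by (rule summable_exp)
  qed
qed

text \<open>Restoring \<open>fps_X ^ K\<close> gives a formal antiderivative of the gamma integrand:
  differentiation produces the factor \<open>K + m\<close>, which cancels the denominator of the
  coefficient with index \<open>m\<close>.\<close>

lemma fps_deriv_inc_gamma_fps: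
  assumes "K \<ge> 1"
  shows "fps_deriv (fps_X ^ K * inc_gamma_fps K) = fps_X ^ (K - 1) * fps_exp (- 1)"
proof (rule fps_ext)
  fix n :: nat
  show "fps_nth (fps_deriv (fps_X ^ K * inc_gamma_fps K)) n
      = fps_nth (fps_X ^ (K - 1) * fps_exp (- 1)) n"
  \<comment> \<open>Below this bound both coefficients vanish; above it \<open>m\<close> is the
    index in the series without its power of \<open>fps_X\<close>.\<close>
  proof (cases "Suc n < K")
    case True
    then show ?thesis
      by (simp add: fps_deriv_nth fps_X_power_mult_nth del: fps_deriv_mult)
  next
    case False
    then obtain m where n: "Suc n = K + m" by (metis le_add_diff_inverse not_less)
    then have "n - (K - 1) = m" "\<not> n < K - 1" using assms by auto
    moreover have "fps_nth (fps_deriv (fps_X ^ K * inc_gamma_fps K)) n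
        = real (K + m) * ((- 1) ^ m / (fact m * real (K + m)))"
      by (simp add: fps_deriv_nth fps_X_power_mult_nth inc_gamma_fps_def n
          del: fps_deriv_mult of_nat_add of_nat_Suc)
    ultimately show ?thesis
      using assms by (simp add: fps_X_power_mult_nth del: of_nat_add)
  qed
qed

text \<open>No interchange of sum and integral is needed: the entire function
  \<open>eval_fps A\<close> has the integrand as derivative and vanishes at 0 because
  \<open>K \<ge> 1\<close>, so the fundamental theorem of calculus applies.\<close>

lemma norm_lower_inc_gamma_eq_eval_fps:
  assumes K: "K \<ge> 1" and x: "x \<ge> 0"
  shows "norm_lower_inc_gamma K x = x ^ K * eval_fps (inc_gamma_fps K) x / Gamma (real K)"
proof -
  define A where "A = fps_X ^ K * inc_gamma_fps K"
  have radius: "fps_conv_radius A = \<infinity>"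
    using fps_conv_radius_mult[of "fps_X ^ K" "inc_gamma_fps K"] K by (simp add: A_def)
  have eval: "eval_fps A t = t ^ K * eval_fps (inc_gamma_fps K) t" for t
    using K by (simp add: A_def eval_fps_mult)
  have "(eval_fps A has_real_derivative t ^ (K - 1) * exp (- t)) (at t within S)" for t S
    using has_field_derivative_eval_fps[of t A S] K
    unfolding A_def [symmetric] fps_deriv_inc_gamma_fps [OF K, folded A_def]
    by (simp add: radius eval_fps_mult)
  then have "((\<lambda>t. t ^ (K - 1) * exp (- t)) has_integral (eval_fps A x - eval_fps A 0)) {0..x}"
    by (intro fundamental_theorem_of_calculus x)
      (simp add: has_real_derivative_iff_has_vector_derivative)
  then show ?thesis
    using K by (simp add: norm_lower_inc_gamma_def integral_unique eval)
qed

section \<open>Closure of entire power series under ring operations\<close>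

lemma fps_conv_radius_add_infty:
  "fps_conv_radius f = \<infinity> \<Longrightarrow> fps_conv_radius g = \<infinity> \<Longrightarrow> fps_conv_radius (f + g) = \<infinity>"
  using fps_conv_radius_add[of f g] by simp

lemma fps_conv_radius_diff_infty:
  "fps_conv_radius f = \<infinity> \<Longrightarrow> fps_conv_radius g = \<infinity> \<Longrightarrow> fps_conv_radius (f - g) = \<infinity>"
  using fps_conv_radius_diff[of f g] by simp

lemma fps_conv_radius_mult_infty:
  "fps_conv_radius f = \<infinity> \<Longrightarrow> fps_conv_radius g = \<infinity> \<Longrightarrow> fps_conv_radius (f * g) = \<infinity>"
  using fps_conv_radius_mult[of f g] by simp

lemma fps_conv_radius_power_infty:
  "fps_conv_radius f = \<infinity> \<Longrightarrow> fps_conv_radius (f ^ n) = \<infinity>"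
  using fps_conv_radius_power[of f n] by simp

lemma fps_conv_radius_sum_infty:
  "(\<And>i. i \<in> I \<Longrightarrow> fps_conv_radius (f i) = \<infinity>) \<Longrightarrow> fps_conv_radius (\<Sum>i\<in>I. f i) = \<infinity>"
  by (induction I rule: infinite_finite_induct) (auto simp: fps_conv_radius_add_infty)

lemma eval_fps_sum_infty:
  "(\<And>i. i \<in> I \<Longrightarrow> fps_conv_radius (f i) = \<infinity>) \<Longrightarrow>
     eval_fps (\<Sum>i\<in>I. f i) z = (\<Sum>i\<in>I. eval_fps (f i) z)"
  by (induction I rule: infinite_finite_induct)
    (auto simp: eval_fps_add fps_conv_radius_sum_infty)

lemmas fps_conv_radius_infty_intros =
  fps_conv_radius_diff_infty fps_conv_radius_mult_infty fps_conv_radius_power_infty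
  fps_conv_radius_sum_infty

section \<open>Outage probability as a power series\<close>

text \<open>With \<open>p = x ^ K * h(x)\<close>, this is the series of
  \<open>(1 - (1 - p) ^ M) / x ^ K\<close>; the geometric sum avoids any division of series.\<close>

definition outage_fps :: "nat \<Rightarrow> nat \<Rightarrow> real fps" where
  "outage_fps K M =
     (let h = fps_const (1 / Gamma (real K)) * inc_gamma_fps K
      in h * (\<Sum>i<M. (1 - fps_X ^ K * h) ^ i))"

lemma fps_conv_radius_outage_fps [simp]:
  assumes "K \<ge> 1"
  shows "fps_conv_radius (outage_fps K M) = \<infinity>"
  unfolding outage_fps_def Let_def using assms
  by (intro fps_conv_radius_infty_intros) simp_all

text \<open>Since \<open>K \<ge> 1\<close>, each of the \<open>M\<close> powers in the geometric sum
  has constant term 1, and \<open>h\<close> contributes \<open>1 / (K * Gamma K)\<close>.\<close>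

lemma fps_nth_0_outage_fps:
  assumes "K \<ge> 1"
  shows "fps_nth (outage_fps K M) 0 = real M / (real K * Gamma (real K))"
  using assms
  by (simp add: outage_fps_def Let_def inc_gamma_fps_def fps_sum_nth fps_power_zeroth zero_power mult.commute)

lemma eval_outage_fps:
  assumes K: "K \<ge> 1" and x: "x \<ge> 0"
  shows "x ^ K * eval_fps (outage_fps K M) x = 1 - (1 - norm_lower_inc_gamma K x) ^ M"
proof -
  define h where "h = fps_const (1 / Gamma (real K)) * inc_gamma_fps K"
  define p where "p = norm_lower_inc_gamma K x"
  have h: "fps_conv_radius h = \<infinity>"
    unfolding h_def by (intro fps_conv_radius_infty_intros) (use K in simp_all)
  then have Xh: "fps_conv_radius (fps_X ^ K * h) = \<infinity>"
    by (simp add: fps_conv_radius_mult_infty)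
  then have q: "fps_conv_radius (1 - fps_X ^ K * h) = \<infinity>"
    by (simp add: fps_conv_radius_diff_infty)
  have p: "x ^ K * eval_fps h x = p"
    using K x by (simp add: p_def h_def eval_fps_mult norm_lower_inc_gamma_eq_eval_fps)
  have sum_radius: "fps_conv_radius (\<Sum>i<M. (1 - fps_X ^ K * h) ^ i) = \<infinity>"
    by (intro fps_conv_radius_sum_infty fps_conv_radius_power_infty q)
  have "eval_fps (outage_fps K M) x = eval_fps h x * eval_fps (\<Sum>i<M. (1 - fps_X ^ K * h) ^ i) x"
    unfolding outage_fps_def Let_def h_def [symmetric]
    by (simp add: eval_fps_mult h sum_radius)
  also have "eval_fps (\<Sum>i<M. (1 - fps_X ^ K * h) ^ i) x = (\<Sum>i<M. (1 - p) ^ i)"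
    using h q Xh
    by (simp add: eval_fps_sum_infty fps_conv_radius_power_infty eval_fps_power eval_fps_diff
        eval_fps_mult p)
  finally have "x ^ K * eval_fps (outage_fps K M) x = p * (\<Sum>i<M. (1 - p) ^ i)"
    by (simp add: p flip: mult.assoc)
  also have "\<dots> = 1 - (1 - p) ^ M"
    using one_diff_power_eq[of "1 - p" M] by simp
  finally show ?thesis by (simp add: p_def)
qed

text \<open>The expansion of \<open>(p + (1 - p)) ^ M\<close> totals 1, and its term for
  \<open>m = 0\<close> is \<open>(1 - p) ^ M\<close>.\<close>

lemma sum_binomial_ge_1:
  fixes p :: real
  shows "(\<Sum>m=1..M. real (M choose m) * p ^ m * (1 - p) ^ (M - m)) = 1 - (1 - p) ^ M"
proof -
  have "1 = (p + (1 - p)) ^ M" by simp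
  also have "\<dots> = (\<Sum>m\<le>M. real (M choose m) * p ^ m * (1 - p) ^ (M - m))"
    by (rule binomial_ring)
  also have "{..M} = insert 0 {1..M}" by auto
  finally show ?thesis by simp
qed

lemma outage_prob_eq_eval_fps:
  assumes "K \<ge> 1" and "y = eff_threshold D M a \<gamma>th P / mean_sinr P \<sigma> N" and "y \<ge> 0"
  shows "outage_prob K M D a \<gamma>th P \<sigma> N = y ^ K * eval_fps (outage_fps K M) y"
proof -
  have "y = N / (2 * P * \<sigma>\<^sup>2) * eff_threshold D M a \<gamma>th P"
    using assms(2) by (simp add: mean_sinr_def)
  then show ?thesis
    using assms(1,3)
    by (simp only: outage_prob_def Let_def sum_binomial_ge_1 eval_outage_fps)
qed

section \<open>Independence of the threshold from the power, and the closed form\<close>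

text \<open>Signal and interference are proportional to \<open>P\<close>, and multiplication by a
  positive \<open>P\<close> is monotone, so it commutes with the maximum.\<close>

lemma max_margin_eq:
  assumes "finite D" "D \<noteq> {}" "P > 0"
  shows "max_margin D M a \<gamma>th P = P * max_margin D M a \<gamma>th 1"
proof -
  have "P * max_margin D M a \<gamma>th 1
      = (MAX \<delta>\<in>D. P * (signal_power a 1 \<delta> - \<gamma>th * interference_power M a 1 \<delta>))"
    unfolding max_margin_def using assms
    by (subst mono_Max_commute[where f = "(*) P"]) (auto simp: mono_def image_image)
  then show ?thesis
    by (simp add: max_margin_def signal_power_def interference_power_def algebra_simps)
qed

text \<open>This allows one coefficient sequence to serve all operating points, even if the power
  varies along the filter.\<close>

lemma eff_threshold_eq:
  assumes "finite D" "D \<noteq> {}" "P > 0"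
  shows "eff_threshold D M a \<gamma>th P = eff_threshold D M a \<gamma>th 1"
  using assms max_margin_eq[OF assms] by (simp add: eff_threshold_def)

text \<open>The outer exponent \<open>- K\<close> undoes the \<open>K\<close>-th root and inverts
  the bracket, exposing the leading term of the series.\<close>

lemma high_sinr_outage_eq:
  assumes K: "K \<ge> 1" and M: "M \<ge> 1" and T: "eff_threshold D M a \<gamma>th P > 0"
    and s: "mean_sinr P \<sigma> N > 0"
  shows "high_sinr_outage K M D a \<gamma>th P \<sigma> N
    = real M / (real K * Gamma (real K)) * (eff_threshold D M a \<gamma>th P / mean_sinr P \<sigma> N) ^ K"
proof -
  let ?b = "real K * Gamma (real K) / (real M * eff_threshold D M a \<gamma>th P ^ K)"
  have b: "?b > 0" using K M T by (auto intro!: divide_pos_pos mult_pos_pos Gamma_real_pos)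
  have "high_sinr_outage K M D a \<gamma>th P \<sigma> N
      = (?b powr (1 / real K)) powr (- real K) * mean_sinr P \<sigma> N powr (- real K)"
    using s by (simp add: high_sinr_outage_def powr_mult)
  also have "(?b powr (1 / real K)) powr (- real K) = inverse ?b"
    using K M T by (simp add: powr_powr powr_minus)
  also have "mean_sinr P \<sigma> N powr (- real K) = inverse (mean_sinr P \<sigma> N ^ K)"
    using s by (simp add: powr_minus powr_realpow)
  finally show ?thesis by (simp add: field_simps)
qed

theorem corollary2:
  fixes K M :: nat and D :: "nat set" and a :: "nat \<Rightarrow> real" and \<gamma>th :: real
    and P \<sigma> N :: "'i \<Rightarrow> real" and F :: "'i filter"
  assumes "K \<ge> 1" and "M \<ge> 1"
    and "D \<noteq> {}" and "D \<subseteq> {1..M}"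
    and "\<And>i. i \<in> {1..M} \<Longrightarrow> 0 \<le> a i" and "(\<Sum>i=1..M. a i) \<le> 1"
    and "\<gamma>th > 0"
    and "\<And>x. P x > 0" and "\<And>x. \<sigma> x > 0" and "\<And>x. N x > 0"
    and "\<And>x. max_margin D M a \<gamma>th (P x) > 0"
    and high_sinr: "filterlim (\<lambda>x. mean_sinr (P x) (\<sigma> x) (N x)) at_top F"
  shows "(\<exists>c :: nat \<Rightarrow> real. \<forall>x.
           (\<lambda>j. c j * (1 / mean_sinr (P x) (\<sigma> x) (N x)) ^ (K + j))
             sums outage_prob K M D a \<gamma>th (P x) (\<sigma> x) (N x) \<and>
           c 0 * (1 / mean_sinr (P x) (\<sigma> x) (N x)) ^ K
             = high_sinr_outage K M D a \<gamma>th (P x) (\<sigma> x) (N x)) \<and>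
         (\<lambda>x. outage_prob K M D a \<gamma>th (P x) (\<sigma> x) (N x))
           \<sim>[F] (\<lambda>x. high_sinr_outage K M D a \<gamma>th (P x) (\<sigma> x) (N x))"
proof -
  define T where "T = eff_threshold D M a \<gamma>th 1"
  define s where "s x = mean_sinr (P x) (\<sigma> x) (N x)" for x
  define Q where "Q = outage_fps K M"
  have D: "finite D" using assms(4) finite_subset by blast
  have T_eq: "eff_threshold D M a \<gamma>th (P x) = T" for x
    unfolding T_def using D assms(3,8) by (intro eff_threshold_eq)
  \<comment> \<open>\<open>T\<close> is the same at every index, so positivity of the margin at one
    arbitrary index suffices.\<close>
  have T: "T > 0"
    using T_eq[of undefined] assms(7) assms(8,11)[of undefined]
    by (auto simp: eff_threshold_def intro!: divide_pos_pos mult_pos_pos)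
  have s: "s x > 0" for x
    using assms(8-10)[of x] by (auto simp: s_def mean_sinr_def)
  have outage: "outage_prob K M D a \<gamma>th (P x) (\<sigma> x) (N x) = (T / s x) ^ K * eval_fps Q (T / s x)"
    for x
    unfolding Q_def using T s[of x] assms(1)
    by (intro outage_prob_eq_eval_fps) (auto simp: T_eq s_def)
  have Q0: "fps_nth Q 0 = real M / (real K * Gamma (real K))"
    using assms(1) by (simp add: Q_def fps_nth_0_outage_fps)
  have "Gamma (real K) > 0" using assms(1) by (intro Gamma_real_pos) simp
  then have "fps_nth Q 0 > 0"
    unfolding Q0 using assms(1,2) by (intro divide_pos_pos mult_pos_pos) auto
  then have Q0_nz: "fps_nth Q 0 \<noteq> 0" by simp
  have high: "high_sinr_outage K M D a \<gamma>th (P x) (\<sigma> x) (N x) = fps_nth Q 0 * (T / s x) ^ K" for x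
    using high_sinr_outage_eq[of K M D a \<gamma>th "P x" "\<sigma> x" "N x"] T s[of x] assms(1,2)
    by (simp add: T_eq s_def Q0)
  have radius: "fps_conv_radius Q = \<infinity>"
    using assms(1) by (simp add: Q_def)

  \<comment> \<open>Powers of \<open>T\<close> go into the coefficients, which then do not depend on
    \<open>x\<close>.\<close>
  have series: "(\<lambda>j. fps_nth Q j * T ^ (K + j) * (1 / s x) ^ (K + j)) sums
      outage_prob K M D a \<gamma>th (P x) (\<sigma> x) (N x)" for x
  proof -
    have "(\<lambda>j. (T / s x) ^ K * (fps_nth Q j * (T / s x) ^ j)) sums
        ((T / s x) ^ K * eval_fps Q (T / s x))"
      by (intro sums_mult sums_eval_fps) (simp add: radius)
    then show ?thesis
      by (simp add: outage power_add power_divide mult_ac)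
  qed
  have leading: "fps_nth Q 0 * T ^ (K + 0) * (1 / s x) ^ K
      = high_sinr_outage K M D a \<gamma>th (P x) (\<sigma> x) (N x)" for x
    by (simp add: high power_divide)

  have "((\<lambda>x. T / s x) \<longlongrightarrow> 0) F"
    using high_sinr by (intro tendsto_divide_0[OF tendsto_const] filterlim_at_top_imp_at_infinity)
      (simp add: s_def)
  moreover have "isCont (eval_fps Q) 0"
    by (rule continuous_eval_fps) (simp add: radius)
  ultimately have "((\<lambda>x. eval_fps Q (T / s x)) \<longlongrightarrow> eval_fps Q 0) F"
    by (rule isCont_tendsto_compose[rotated])
  then have "((\<lambda>x. eval_fps Q (T / s x) / fps_nth Q 0) \<longlongrightarrow> 1) F"
    using Q0_nz by (auto simp: eval_fps_at_0 intro!: tendsto_eq_intros)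
  \<comment> \<open>The common factor \<open>(T / s x) ^ K\<close> is nonzero and cancels, so the
    quotient inherits the limit 1.\<close>
  moreover have "outage_prob K M D a \<gamma>th (P x) (\<sigma> x) (N x) /
      high_sinr_outage K M D a \<gamma>th (P x) (\<sigma> x) (N x) = eval_fps Q (T / s x) / fps_nth Q 0" for x
    using T s[of x] by (simp add: outage high)
  ultimately have "(\<lambda>x. outage_prob K M D a \<gamma>th (P x) (\<sigma> x) (N x))
      \<sim>[F] (\<lambda>x. high_sinr_outage K M D a \<gamma>th (P x) (\<sigma> x) (N x))"
    by (intro asymp_equivI') simp
  then show ?thesis
    using series leading unfolding s_def
    by (intro conjI exI[of _ "\<lambda>j. fps_nth Q j * T ^ (K + j)"] allI) blast+
qed

end
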